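(* For $m \geq 3$ and $n \geq 6$, writing $n=3k$, $3k+1$ or $3k+2$ with $k$ a positive integer, $$\gamma(C_n\times K_m)= \begin{cases} 2k, & n=3k;\\ 2k+1, & n=3k+1;\\ 2k+2, & n=3k+2.\end{cases}$$
   Context: $C_n$ is the cycle on $\{1,\dots,n\}$ with edges $\{i,i+1\}$ and $\{n,1\}$; $K_m$ is the complete graph on $\{1,\dots,m\}$. The direct product $G\times H$ has vertex set $V(G)\times V(H)$ with $(g_1,h_1)\sim(g_2,h_2)$ iff $g_1g_2\in E(G)$ and $h_1h_2\in E(H)$. $\gamma(G)$ denotes the domination number: the minimum size of a set $D$ of vertices such that every vertex not in $D$ is adjacent to a vertex of $D$. *)

theory Defs
  imports Main
begin

text \<open>
  A simple graph is a pair of a vertex set and a set of edges, each edge being an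
  unordered pair of distinct vertices.
\<close>

type_synonym 'a graph = "'a set \<times> 'a set set"

abbreviation verts :: "'a graph \<Rightarrow> 'a set" where
  "verts G \<equiv> fst G"

abbreviation edges :: "'a graph \<Rightarrow> 'a set set" where
  "edges G \<equiv> snd G"

definition adjacent :: "'a graph \<Rightarrow> 'a \<Rightarrow> 'a \<Rightarrow> bool" where
  "adjacent G u v \<longleftrightarrow> {u, v} \<in> edges G"

text \<open>A simple graph, hence meaningful, only for \<open>n \<ge> 3\<close>.\<close>

definition cycle_graph :: "nat \<Rightarrow> nat graph" where
  "cycle_graph n = ({1..n}, {{i, i + 1} | i. 1 \<le> i \<and> i < n} \<union> {{n, 1}})"

definition complete_graph :: "nat \<Rightarrow> nat graph" where
  "complete_graph m =
     ({1..m}, {{i, j} | i j. i \<in> {1..m} \<and> j \<in> {1..m} \<and> i \<noteq> j})"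

definition direct_product :: "'a graph \<Rightarrow> 'b graph \<Rightarrow> ('a \<times> 'b) graph" where
  "direct_product G H =
     (verts G \<times> verts H,
      {{(g1, h1), (g2, h2)} | g1 h1 g2 h2. adjacent G g1 g2 \<and> adjacent H h1 h2})"

definition dominating_set :: "'a graph \<Rightarrow> 'a set \<Rightarrow> bool" where
  "dominating_set G D \<longleftrightarrow>
     D \<subseteq> verts G \<and> (\<forall>v \<in> verts G - D. \<exists>u \<in> D. adjacent G u v)"

definition domination_number :: "'a graph \<Rightarrow> nat" where
  "domination_number G = (LEAST d. \<exists>D. finite D \<and> dominating_set G D \<and> card D = d)"

end

theory Submission
  imports Defs
begin

text \<open>
  Any three consecutive columns of \<open>C\<^sub>n \<times> K\<^sub>m\<close> contain at least two vertices of a dominating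
  set: if a column and its two neighbours contained only one such vertex \<open>(x, r)\<close>, then some vertex
  of the middle column would be undominated (the one in row \<open>r\<close> if \<open>(x, r)\<close> lies in a neighbouring
  column, any one outside row \<open>r\<close> otherwise). Double counting gives \<open>3|D| \<ge> 2n\<close>, that is
  \<open>|D| \<ge> n - \<lfloor>n/3\<rfloor>\<close>.

  Conversely, cut the columns into blocks of three, leave the last column of each block
  empty and put one vertex in each of the others, using the same row throughout a block.
  This dominates as soon as cyclically consecutive blocks use different rows, for which
  three rows suffice; an incomplete last block reuses the row of the first block.
\<close>

lemma adjacent_complete_graph_iff:
  "adjacent (complete_graph m) i j \<longleftrightarrow> i \<in> {1..m} \<and> j \<in> {1..m} \<and> i \<noteq> j"
  unfolding adjacent_def complete_graph_def by (auto simp: doubleton_eq_iff)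

lemma adjacent_commute: "adjacent G u v \<longleftrightarrow> adjacent G v u"
  unfolding adjacent_def by (simp add: insert_commute)

lemma adjacent_direct_product_iff:
  "adjacent (direct_product G H) (g, h) (g', h') \<longleftrightarrow> adjacent G g g' \<and> adjacent H h h'"
proof -
  have iff: "adjacent (direct_product G H) u v \<longleftrightarrow>
      (\<exists>g1 h1 g2 h2. {u, v} = {(g1, h1), (g2, h2)} \<and> adjacent G g1 g2 \<and> adjacent H h1 h2)" for u v
    by (simp add: adjacent_def[of "direct_product G H"]) (simp add: direct_product_def)
  show ?thesis
    unfolding iff by (auto simp: doubleton_eq_iff adjacent_commute)
qed

lemma adjacent_cycle_graph_iff:
  "adjacent (cycle_graph n) i j \<longleftrightarrow>
     (1 \<le> i \<and> i < n \<and> j = i + 1) \<or> (1 \<le> j \<and> j < n \<and> i = j + 1) \<or>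
     (i = n \<and> j = 1) \<or> (i = 1 \<and> j = n)"
  unfolding adjacent_def cycle_graph_def by (auto simp: doubleton_eq_iff)

text \<open>In the double count, a vertex in column \<open>x\<close> is counted only from
  \<open>x\<close> and its two cyclic neighbours.\<close>

lemma card_closed_nbhd_cycle_graph_le:
  "card {i \<in> {1..n}. i = x \<or> adjacent (cycle_graph n) i x} \<le> 3"
proof -
  define l where "l = (if x = 1 then n else x - 1)"
  define r where "r = (if x = n then 1 else x + 1)"
  have "{i \<in> {1..n}. i = x \<or> adjacent (cycle_graph n) i x} \<subseteq> {l, x, r}"
    unfolding l_def r_def by (auto simp: adjacent_cycle_graph_iff)
  then have "card {i \<in> {1..n}. i = x \<or> adjacent (cycle_graph n) i x} \<le> card {l, x, r}"
    by (intro card_mono) auto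
  also have "\<dots> \<le> 3"
    by (simp add: card_insert_if)
  finally show ?thesis .
qed

lemma two_le_card_three_columns:
  assumes "m \<ge> 2" "n \<ge> 2" "i \<in> {1..n}" "finite D"
    and dom: "dominating_set (direct_product (cycle_graph n) (complete_graph m)) D"
  shows "2 \<le> card {u \<in> D. i = fst u \<or> adjacent (cycle_graph n) i (fst u)}" (is "2 \<le> card ?N")
proof (rule ccontr)
  assume "\<not> 2 \<le> card ?N"
  then have le1: "card ?N \<le> Suc 0" by simp
  have "finite ?N" using \<open>finite D\<close> by simp
  then have uniq: "u = v" if "u \<in> ?N" "v \<in> ?N" for u v
    using le1 that card_le_Suc0_iff_eq[of ?N] by blast
  have vertex: "(i, j) \<in> D \<or>
      (\<exists>x r. (x, r) \<in> ?N \<and> adjacent (cycle_graph n) i x \<and> r \<in> {1..m} \<and> r \<noteq> j)"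
    if "j \<in> {1..m}" for j
  proof -
    have "(i, j) \<in> D \<or>
        (\<exists>u \<in> D. adjacent (direct_product (cycle_graph n) (complete_graph m)) u (i, j))"
      using dom that \<open>i \<in> {1..n}\<close>
      unfolding dominating_set_def direct_product_def[of "cycle_graph n"]
      by (auto simp: cycle_graph_def complete_graph_def)
    then show ?thesis
      by (fastforce simp: adjacent_direct_product_iff adjacent_complete_graph_iff
          adjacent_commute[of _ i])
  qed
  have irrefl: "\<not> adjacent (cycle_graph n) i i"
    using \<open>n \<ge> 2\<close> by (auto simp: adjacent_cycle_graph_iff)
  \<comment> \<open>If \<open>(i, j)\<close> were in \<open>D\<close>, it would be all of
    \<open>?N\<close>; but any other vertex \<open>(i, j')\<close> of the column needs itself or a
    vertex of a neighbouring column in \<open>?N\<close>.\<close>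
  have column: "(i, j) \<notin> D" if "j \<in> {1..m}" for j
  proof
    assume "(i, j) \<in> D"
    obtain j' where j': "j' \<in> {1..m}" "j' \<noteq> j"
      using \<open>m \<ge> 2\<close> that[of "if j = 1 then 2 else 1"] by auto
    have "(i, j) \<in> ?N" using \<open>(i, j) \<in> D\<close> by simp
    with vertex[OF j'(1)] j'(2) irrefl show False
      using uniq[of "(i, j)"] by fastforce
  qed
  \<comment> \<open>Column \<open>i\<close> is now dominated from outside. Whatever dominates row 1
    lies in some row \<open>r\<close>, and \<open>(i, r)\<close> then needs a second vertex, in a
    row other than \<open>r\<close>.\<close>
  obtain x r where xr: "(x, r) \<in> ?N" "adjacent (cycle_graph n) i x" "r \<in> {1..m}"
    using vertex[of 1] column[of 1] \<open>m \<ge> 2\<close> by auto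
  obtain y s where "(y, s) \<in> ?N" "s \<noteq> r"
    using vertex[of r] column[of r] xr(3) by blast
  then show False
    using uniq[OF xr(1)] by blast
qed

lemma dominating_set_cycle_complete_card_ge:
  assumes "m \<ge> 2" "n \<ge> 2" "finite D"
    and dom: "dominating_set (direct_product (cycle_graph n) (complete_graph m)) D"
  shows "2 * n \<le> 3 * card D"
proof -
  let ?near = "\<lambda>i x. i = x \<or> adjacent (cycle_graph n) i x"
  have "2 * n = (\<Sum>i\<in>{1..n}. 2)" by simp
  also have "\<dots> \<le> (\<Sum>i\<in>{1..n}. card {u \<in> D. ?near i (fst u)})"
    using assms by (intro sum_mono two_le_card_three_columns[of m]) auto
  also have "\<dots> = (\<Sum>i\<in>{1..n}. \<Sum>u\<in>D. if ?near i (fst u) then 1 else 0)"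
    using \<open>finite D\<close> by (simp add: sum.If_cases Int_def)
  also have "\<dots> = (\<Sum>u\<in>D. \<Sum>i\<in>{1..n}. if ?near i (fst u) then 1 else 0)"
    by (rule sum.swap)
  also have "\<dots> = (\<Sum>u\<in>D. card {i \<in> {1..n}. ?near i (fst u)})"
    by (simp add: sum.If_cases Int_def)
  also have "\<dots> \<le> (\<Sum>u\<in>D. 3)"
    by (intro sum_mono card_closed_nbhd_cycle_graph_le)
  finally show ?thesis by simp
qed

text \<open>Counts the columns that receive a vertex in the construction.\<close>

lemma card_not_multiples_of_3: "card {i \<in> {1..n}. \<not> 3 dvd i} = n - n div (3::nat)"
proof -
  have "{i \<in> {1..n}. \<not> 3 dvd i} = {1..n} - (*) 3 ` {1..n div 3}"
    by (auto simp: dvd_def)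
  also have "card \<dots> = n - card ((*) 3 ` {1..n div 3})"
    by (subst card_Diff_subset) auto
  also have "card ((*) 3 ` {1..n div 3}) = n div 3"
    by (simp add: card_image inj_on_def)
  finally show ?thesis .
qed

text \<open>Block \<open>t\<close> has its vertices in columns 3t+1 and 3t+2. Index \<open>k\<close>
  is the incomplete last block or, if \<open>n = 3 * k\<close>, block 0 reached again around the
  cycle; hence it shares row 1 with block 0.\<close>

definition block_row :: "nat \<Rightarrow> nat \<Rightarrow> nat" where
  "block_row k t = (if t = 0 \<or> t = k then 1 else if odd t then 2 else 3)"

text \<open>For \<open>k = 1\<close> the indices 0 and 1 would share row 1; this is where
  \<open>n \<ge> 6\<close> enters.\<close>

lemma block_row_Suc_neq: "k \<ge> 2 \<Longrightarrow> t < k \<Longrightarrow> block_row k (Suc t) \<noteq> block_row k t"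
  by (auto simp: block_row_def)

lemma ex_dominating_set_cycle_complete:
  assumes "m \<ge> 3" "n \<ge> 6"
  shows "\<exists>D. finite D \<and> dominating_set (direct_product (cycle_graph n) (complete_graph m)) D
           \<and> card D \<le> n - n div 3"
proof (intro exI conjI)
  define k where "k = n div 3"
  have "k \<ge> 2" using \<open>n \<ge> 6\<close> by (simp add: k_def)
  have n_cases: "n = 3 * k \<or> n = 3 * k + 1 \<or> n = 3 * k + 2"
    unfolding k_def by presburger
  define I where "I = {i \<in> {1..n}. \<not> 3 dvd i}"
  define f where "f = (\<lambda>i. (i, block_row k (i div 3)))"
  let ?D = "f ` I"
  let ?G = "direct_product (cycle_graph n) (complete_graph m)"
  have row: "block_row k t \<in> {1..m}" for t
    using \<open>m \<ge> 3\<close> by (auto simp: block_row_def)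
  have ends: "block_row k 0 = block_row k k"
    by (simp add: block_row_def)
  show "finite ?D" by (simp add: I_def)
  show "card ?D \<le> n - n div 3"
    using card_image_le[of I f] card_not_multiples_of_3[of n] by (simp add: I_def)
  have dominated: "\<exists>u\<in>?D. adjacent ?G u (i, j)"
    if "x \<in> I" "adjacent (cycle_graph n) x i" "j \<in> {1..m}" "j \<noteq> block_row k (x div 3)" for x i j
    using that row[of "x div 3"] unfolding f_def
    by (intro bexI[of _ "(x, block_row k (x div 3))"])
       (auto simp: adjacent_direct_product_iff adjacent_complete_graph_iff)
  show "dominating_set ?G ?D"
    unfolding dominating_set_def
  proof (intro conjI ballI)
    show "?D \<subseteq> verts ?G"
      using row by (auto simp: f_def I_def direct_product_def cycle_graph_def complete_graph_def)
    fix v assume v: "v \<in> verts ?G - ?D"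
    obtain i j where [simp]: "v = (i, j)" by fastforce
    have i: "i \<in> {1..n}" and j: "j \<in> {1..m}"
      using v by (auto simp: direct_product_def cycle_graph_def complete_graph_def)
    have notin: "j \<noteq> block_row k (i div 3)" if "i \<in> I"
      using v that by (auto simp: f_def)
    have div3: "(3 * t + 1) div 3 = t" "(3 * t + 2) div 3 = t" "(3 * t + 4) div 3 = Suc t"
      for t :: nat by presburger+
    \<comment> \<open>Columns start at 1, so \<open>t\<close> is the block of \<open>i\<close> even
      for the empty column 3t+3, where \<open>i div 3\<close> is already t+1.\<close>
    consider t where "i = 3 * t + 1" | t where "i = 3 * t + 2" | t where "i = 3 * t + 3"
    proof -
      have "\<exists>t. i = 3 * t + 1 \<or> i = 3 * t + 2 \<or> i = 3 * t + 3"
        using i by simp presburger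
      then show thesis using that by blast
    qed
    then show "\<exists>u\<in>?D. adjacent ?G u v"
    proof cases
      \<comment> \<open>The other used column of the block has the same row, which \<open>j\<close>
        avoids. If \<open>i = n\<close> that column is missing, and column 1 replaces it.\<close>
      case (1 t)
      have "i \<in> I" using i 1 by (simp add: I_def) presburger
      then have jt: "j \<noteq> block_row k t" using notin div3(1) unfolding 1 by simp
      show ?thesis
      proof (cases "i = n")
        case True
        with 1 n_cases have "t = k" by presburger
        then show ?thesis
          using dominated[of 1 i j] True jt j ends \<open>n \<ge> 6\<close>
          by (auto simp: I_def adjacent_cycle_graph_iff)
      next
        case False
        have "\<not> 3 dvd 3 * t + 2" by presburger
        then show ?thesis
          using dominated[of "3 * t + 2" i j, unfolded div3] False 1 i jt j
          by (auto simp: I_def adjacent_cycle_graph_iff)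
      qed
    next
      case (2 t)
      have "i \<in> I" using i 2 by (simp add: I_def) presburger
      then have jt: "j \<noteq> block_row k t" using notin div3(2) unfolding 2 by simp
      have "\<not> 3 dvd 3 * t + 1" by presburger
      then show ?thesis
        using dominated[of "3 * t + 1" i j, unfolded div3] 2 i jt j
        by (auto simp: I_def adjacent_cycle_graph_iff)
    next
      \<comment> \<open>The empty column lies between two blocks with different rows, so
        \<open>j\<close> differs from at least one of them.\<close>
      case (3 t)
      have "t < k" using 3 i n_cases by auto
      show ?thesis
      proof (cases "j = block_row k t")
        case False
        have "\<not> 3 dvd 3 * t + 2" by presburger
        then show ?thesis
          using dominated[of "3 * t + 2" i j, unfolded div3] 3 i False j
          by (auto simp: I_def adjacent_cycle_graph_iff)
      next
        case True
        then have jt: "j \<noteq> block_row k (Suc t)"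
          using block_row_Suc_neq[OF \<open>k \<ge> 2\<close> \<open>t < k\<close>] by simp
        show ?thesis
        proof (cases "i = n")
          case True
          with 3 n_cases have "Suc t = k" by presburger
          then show ?thesis
            using dominated[of 1 i j] True jt j ends \<open>n \<ge> 6\<close>
            by (auto simp: I_def adjacent_cycle_graph_iff)
        next
          case False
          have "\<not> 3 dvd 3 * t + 4" by presburger
          then show ?thesis
            using dominated[of "3 * t + 4" i j, unfolded div3] False 3 i jt j
            by (auto simp: I_def adjacent_cycle_graph_iff)
        qed
      qed
    qed
  qed
qed

text \<open>\<open>n - n div 3\<close> is 2n/3 rounded up, one closed form for all three
  residues.\<close>

lemma domination_number_cycle_complete:
  assumes "m \<ge> 3" "n \<ge> 6"
  shows "domination_number (direct_product (cycle_graph n) (complete_graph m)) = n - n div 3"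
proof -
  let ?G = "direct_product (cycle_graph n) (complete_graph m)"
  have lower: "n - n div 3 \<le> card D" if "finite D" "dominating_set ?G D" for D
  proof -
    have "2 * n \<le> 3 * card D"
      using dominating_set_cycle_complete_card_ge[OF _ _ that] assms by simp
    then show ?thesis by linarith
  qed
  obtain D where "finite D" "dominating_set ?G D" "card D \<le> n - n div 3"
    using ex_dominating_set_cycle_complete[OF assms] by blast
  with lower have "\<exists>D. finite D \<and> dominating_set ?G D \<and> card D = n - n div 3"
    using le_antisym by blast
  then show ?thesis
    unfolding domination_number_def by (rule Least_equality) (use lower in blast)
qed

theorem theorem4p2:
  fixes m n k :: nat
  assumes "m \<ge> 3" and "n \<ge> 6" and "k \<ge> 1"
  shows "(n = 3 * k \<longrightarrow>
            domination_number (direct_product (cycle_graph n) (complete_graph m)) = 2 * k) \<and>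
         (n = 3 * k + 1 \<longrightarrow>
            domination_number (direct_product (cycle_graph n) (complete_graph m)) = 2 * k + 1) \<and>
         (n = 3 * k + 2 \<longrightarrow>
            domination_number (direct_product (cycle_graph n) (complete_graph m)) = 2 * k + 2)"
  using domination_number_cycle_complete[OF assms(1,2)] by auto

end
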